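(* Let $a_1,\dots,a_4$ be the exponents of a Kollár surface with $w^*>1$, and assume $\gcd(w_i,w_{i+2})=1$ for all $i$. Then $$12\Big(\sum_{1\le i<j\le4}s(\mu_i,\mu_j;w^* )+\sum_{i=1}^4 s(w_{i+2},w_{i+3};w_i)\Big)=\frac{d\,(d-\sum_{i}w_i)^2}{\prod_iw_i}-\sum_{i=1}^4\frac{2}{w_i}-\frac{{w^*}^2-6w^*+4}{w^*}.$$
   Context: Indices are taken modulo $4$. The exponents $a_1,\dots,a_4$ of a Kollár surface are positive integers with $(a_i,a_{i+2})\neq(1,1)$ for all $i$. Put $W_i=a_{i+1}a_{i+2}a_{i+3}-a_{i+2}a_{i+3}+a_{i+3}-1$, $D=a_1a_2a_3a_4-1$, $w^*=\gcd(W_1,\dots,W_4)$, $w_i=W_i/w^*$, $d=D/w^*$. The integers $0<\mu_i<w^*$ are defined by $\mu_1\equiv a_2a_3a_4$, $\mu_2\equiv-a_3a_4$, $\mu_3\equiv a_4$, $\mu_4\equiv-1\pmod{w^*}$; they are coprime to $w^*$. For $n\ge1$ and integers $a,b$ coprime to $n$, the generalized Dedekind sum is $s(a,b;n)=\sum_{i=1}^{n-1}\big(\big(\tfrac{ia}{n}\big)\big)\big(\big(\tfrac{ib}{n}\big)\big)$, where $((x))=x-\lfloor x\rfloor-\tfrac12$ for rational $x$ (so $s(a,b;1)=0$). *)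

theory Defs
  imports Complex_Main "HOL-Number_Theory.Cong"
begin

text \<open>
  A 4-tuple with indices modulo 4 is represented by a sequence of period 4 on the naturals,
  so the entries are \<open>a 1, ..., a 4\<close> and, for instance, \<open>a 5 = a 1\<close>.
\<close>

definition kollar_exponents :: "(nat \<Rightarrow> int) \<Rightarrow> bool" where
  "kollar_exponents a \<longleftrightarrow>
     (\<forall>i. a (i + 4) = a i) \<and> (\<forall>i. a i > 0) \<and> (\<forall>i. (a i, a (i + 2)) \<noteq> (1, 1))"

definition kollar_W :: "(nat \<Rightarrow> int) \<Rightarrow> nat \<Rightarrow> int" where
  "kollar_W a i = a (i + 1) * a (i + 2) * a (i + 3) - a (i + 2) * a (i + 3) + a (i + 3) - 1"

definition kollar_D :: "(nat \<Rightarrow> int) \<Rightarrow> int" where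
  "kollar_D a = a 1 * a 2 * a 3 * a 4 - 1"

definition kollar_wstar :: "(nat \<Rightarrow> int) \<Rightarrow> int" where
  "kollar_wstar a = (GCD i\<in>{1..4}. kollar_W a i)"

text \<open>The divisions in the next two definitions are exact, see \<open>kollar_wstar_dvd_W\<close> and
  \<open>kollar_wstar_dvd_D\<close> below.\<close>

definition kollar_w :: "(nat \<Rightarrow> int) \<Rightarrow> nat \<Rightarrow> int" where
  "kollar_w a i = kollar_W a i div kollar_wstar a"

definition kollar_d :: "(nat \<Rightarrow> int) \<Rightarrow> int" where
  "kollar_d a = kollar_D a div kollar_wstar a"

text \<open>The value at an integer is \<open>-1/2\<close> here, not \<open>0\<close> as in the usual convention.\<close>

definition sawtooth :: "real \<Rightarrow> real" where
  "sawtooth x = x - of_int \<lfloor>x\<rfloor> - 1 / 2"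

text \<open>Meant for \<open>n \<ge> 1\<close> and \<open>a\<close>, \<open>b\<close> coprime to \<open>n\<close>.\<close>

definition dedekind_sum :: "int \<Rightarrow> int \<Rightarrow> int \<Rightarrow> real" where
  "dedekind_sum a b n =
     (\<Sum>i=1..n-1. sawtooth (of_int (i * a) / of_int n) * sawtooth (of_int (i * b) / of_int n))"

lemma kollar_W_periodic:
  assumes "kollar_exponents a"
  shows "kollar_W a (i + 4) = kollar_W a i"
proof -
  have p: "a (k + 4) = a k" for k
    using assms by (simp add: kollar_exponents_def)
  show ?thesis
    using p[of "i + 1"] p[of "i + 2"] p[of "i + 3"] by (simp add: kollar_W_def add.commute add.left_commute)
qed

lemma kollar_wstar_dvd_W:
  assumes "kollar_exponents a"
  shows "kollar_wstar a dvd kollar_W a i"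
proof (induction i rule: less_induct)
  case (less i)
  show ?case
  proof (cases "i \<in> {1..4}")
    case True
    then show ?thesis unfolding kollar_wstar_def by (intro Gcd_dvd imageI)
  next
    case False
    show ?thesis
    proof (cases "i = 0")
      case True
      have "kollar_wstar a dvd kollar_W a 4"
        unfolding kollar_wstar_def by (intro Gcd_dvd imageI) auto
      with True kollar_W_periodic[OF assms, of 0] show ?thesis by simp
    next
      case nz: False
      with False obtain k where k: "i = k + 4"
        by (metis atLeastAtMost_iff add.commute le_Suc_ex less_one nat_le_linear not_less)
      with less.IH[of k] kollar_W_periodic[OF assms, of k] show ?thesis by simp
    qed
  qed
qed

lemma kollar_D_eq:
  assumes "kollar_exponents a"
  shows "kollar_D a = a 1 * kollar_W a 1 + kollar_W a 2"
proof -
  have "a (k + 4) = a k" for k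
    using assms by (simp add: kollar_exponents_def)
  from this[of 1] have "a 5 = a 1" by simp
  then show ?thesis by (simp add: kollar_D_def kollar_W_def eval_nat_numeral algebra_simps)
qed

lemma kollar_wstar_dvd_D:
  assumes "kollar_exponents a"
  shows "kollar_wstar a dvd kollar_D a"
  using kollar_wstar_dvd_W[OF assms] by (simp add: kollar_D_eq[OF assms])

end

theory Submission
  imports Defs
begin

text \<open>
  Every Dedekind sum in the statement can be normalised to the classical form \<open>s(h; n) = s(h, 1; n)\<close>,
  because multiplying both arguments by a unit modulo \<open>n\<close> only permutes the summands. The proof then
  consists in cutting these sums into simpler ones by one tool, the three-term relation
  \<open>dedekind_three_term\<close>. It says that if the cone spanned by two plane lattice vectors is cut by a third,
  the Dedekind sums of the three cones, with index \<open>b\<close>, \<open>d\<close> and \<open>q\<close>, add up with suitable signs to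
  \<open>((b\<^sup>2 + d\<^sup>2 + q\<^sup>2) / (b d q) - 3) / 12\<close>. Ordinary reciprocity is the case \<open>d = 1\<close>, and the general
  case follows from it by the Euclidean algorithm.

  The geometric picture behind the choice of cuts is as follows. The monomials
  \<open>u\<^sub>i = x\<^sub>i^(a\<^sub>i) x\<^bsub>i+1\<^esub>\<close>, whose sum vanishes on the surface, define a rational map to a plane. It makes
  the surface birational to a cyclic cover of degree \<open>w\<^sup>*\<close> branched along the four lines \<open>u\<^sub>i = 0\<close>.
  The six sums \<open>s(\<mu>\<^sub>i, \<mu>\<^sub>j; w\<^sup>*)\<close> belong to the intersection points of these lines, the four sums \<open>s(w\<^bsub>i+2\<^esub>, w\<^bsub>i+3\<^esub>; w\<^sub>i)\<close> to the coordinate vertices of the surface. The curves on a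
  common resolution of both models cut the cones at these points into matching pieces, up to explicit
  rational terms:
  \<^item> for adjacent lines, \<open>s(\<mu>\<^sub>i, \<mu>\<^bsub>i+1\<^esub>; w\<^sup>*) = - s(a\<^bsub>i+1\<^esub>; w\<^sup>*)\<close>, which reciprocity turns into
    \<open>s(w\<^sup>*; a\<^bsub>i+1\<^esub>)\<close>;
  \<^item> for opposite lines (\<open>diagonal\<close>), \<open>s(\<mu>\<^sub>i, \<mu>\<^bsub>i+2\<^esub>; w\<^sup>*)\<close> is cut into \<open>s(w\<^bsub>i-1\<^esub>; a\<^sub>i - 1)\<close> and
    \<open>s(w\<^bsub>i+1\<^esub>; a\<^bsub>i+2\<^esub> - 1)\<close>;
  \<^item> at a vertex (\<open>vertex\<close>), \<open>s(w\<^bsub>i+2\<^esub>, w\<^bsub>i+3\<^esub>; w\<^sub>i)\<close> is cut into \<open>- s(w\<^sup>*; a\<^bsub>i+2\<^esub>)\<close> and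
    \<open>- s(w\<^bsub>i+2\<^esub>; a\<^bsub>i+3\<^esub> - 1)\<close>.

  In the total all pieces cancel, and an identity between rational functions of the exponents and \<open>w\<^sup>*\<close> remains.
  Exponents equal to 1 need care: the moduli \<open>a\<^sub>i - 1\<close> then vanish and the last two cuts degenerate.
  For this reason one diagonal is always treated together with the two vertices that share pieces with it
  (\<open>diagonal_sum_eq\<close>): their common sum is given by one formula without \<open>a\<^sub>i - 1\<close> in the denominator,
  which also covers the degenerate case.
\<close>

section \<open>Elementary properties of Dedekind sums\<close>

lemma sawtooth_fraction:
  assumes "n > 0"
  shows "sawtooth (of_int m / of_int n) = of_int (m mod n) / of_int n - 1 / 2"
proof -
  have "m = n * (m div n) + m mod n" by simp
  then have "real_of_int m = of_int n * of_int (m div n) + of_int (m mod n)"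
    by (metis of_int_add of_int_mult)
  then have "real_of_int m / of_int n - of_int (m div n) = of_int (m mod n) / of_int n"
    using assms by (simp add: divide_simps)
  then show ?thesis
    by (simp add: sawtooth_def floor_divide_of_int_eq)
qed

text \<open>Sums of residues are easier to handle than the sawtooth itself: they make periodicity in the
  arguments evident and expose the permutation of residues by a unit.\<close>

lemma dedekind_sum_residues:
  "dedekind_sum a b n =
    (\<Sum>i=1..n-1. (of_int (i * a mod n) / of_int n - 1 / 2) * (of_int (i * b mod n) / of_int n - 1 / 2))"
  unfolding dedekind_sum_def by (rule sum.cong) (auto simp: sawtooth_fraction simp del: of_int_mult)

lemma dedekind_sum_commute: "dedekind_sum a b n = dedekind_sum b a n"
  by (simp add: dedekind_sum_def mult.commute)

lemma dedekind_sum_cong: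
  assumes "[a = a'] (mod n)" "[b = b'] (mod n)"
  shows "dedekind_sum a b n = dedekind_sum a' b' n"
proof -
  have "i * a mod n = i * a' mod n" "i * b mod n = i * b' mod n" for i
    using assms by (metis cong_def cong_scalar_left)+
  then show ?thesis by (simp add: dedekind_sum_residues)
qed

lemma dedekind_sum_modulus_1 [simp]: "dedekind_sum a b 1 = 0"
  by (simp add: dedekind_sum_def)

lemma mult_mod_nonzero:
  fixes c n i :: int
  assumes "coprime c n" "i \<in> {1..n-1}"
  shows "i * c mod n \<in> {1..n-1}"
proof -
  have "\<not> n dvd i * c"
    using assms by (metis coprime_commute coprime_dvd_mult_left_iff atLeastAtMost_iff zdvd_not_zless
        int_one_le_iff_zero_less zle_diff1_eq)
  moreover have "n > 0" using assms by auto
  moreover from this have "0 \<le> i * c mod n" "i * c mod n < n" by simp_all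
  ultimately show ?thesis
    by (simp add: dvd_eq_mod_eq_0)
qed

lemma bij_betw_mult_mod:
  fixes c n :: int
  assumes "coprime c n"
  shows "bij_betw (\<lambda>i. i * c mod n) {1..n-1} {1..n-1}"
proof -
  have inj: "inj_on (\<lambda>i. i * c mod n) {1..n-1}"
  proof (rule inj_onI)
    fix x y assume xy: "x \<in> {1..n-1}" "y \<in> {1..n-1}" and eq: "x * c mod n = y * c mod n"
    from eq have "[x = y] (mod n)" using assms by (metis cong_def cong_mult_rcancel)
    then show "x = y" using xy by (simp add: cong_def)
  qed
  have "(\<lambda>i. i * c mod n) ` {1..n-1} = {1..n-1}"
    by (rule endo_inj_surj[OF _ _ inj]) (use mult_mod_nonzero[OF assms] in auto)
  then show ?thesis using inj by (simp add: bij_betw_def)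
qed

text \<open>A unit permutes the nonzero residues, so it may be cancelled from both arguments.\<close>

lemma dedekind_sum_scale:
  assumes "coprime c n"
  shows "dedekind_sum (c * a) (c * b) n = dedekind_sum a b n"
proof -
  define g where "g i = (of_int (i * a mod n) / of_int n - 1 / 2 :: real) * (of_int (i * b mod n) / of_int n - 1 / 2)" for i
  have "dedekind_sum (c * a) (c * b) n = (\<Sum>i=1..n-1. g (i * c mod n))"
    unfolding dedekind_sum_residues g_def
    by (rule sum.cong) (simp_all add: mod_mult_left_eq mult.assoc)
  also have "\<dots> = (\<Sum>i=1..n-1. g i)"
    by (rule sum.reindex_bij_betw[OF bij_betw_mult_mod[OF assms]])
  finally show ?thesis by (simp add: g_def dedekind_sum_residues)
qed

text \<open>The sawtooth is odd except at the integers, where it takes the value \<open>-1/2\<close>; coprimality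
  keeps the arguments away from them.\<close>

lemma dedekind_sum_minus:
  assumes "coprime a n"
  shows "dedekind_sum (- a) b n = - dedekind_sum a b n"
  unfolding dedekind_sum_residues sum_negf[symmetric]
proof (rule sum.cong)
  fix i assume i: "i \<in> {1..n-1}"
  then have "i * a mod n \<noteq> 0" using mult_mod_nonzero[OF assms i] by auto
  then have "i * (- a) mod n = n - i * a mod n"
    by (simp add: zmod_zminus1_eq_if)
  then have "real_of_int (i * - a mod n) / of_int n - 1 / 2 = - (of_int (i * a mod n) / of_int n - 1 / 2)"
    using i by (simp add: diff_divide_distrib)
  then show "(real_of_int (i * - a mod n) / of_int n - 1 / 2) * (of_int (i * b mod n) / of_int n - 1 / 2) =
      - ((of_int (i * a mod n) / of_int n - 1 / 2) * (of_int (i * b mod n) / of_int n - 1 / 2))"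
    by (simp only: mult_minus_left)
qed simp

lemma dedekind_sum_normalize:
  assumes "coprime b n" "[a = h * b] (mod n)"
  shows "dedekind_sum a b n = dedekind_sum h 1 n"
  using dedekind_sum_scale[OF assms(1), of h 1] dedekind_sum_cong[OF assms(2) cong_refl, of b]
  by (simp add: mult.commute)

lemma dedekind_sum_inverse:
  assumes "[h * h' = 1] (mod n)"
  shows "dedekind_sum h 1 n = dedekind_sum h' 1 n"
proof -
  have "coprime h n"
    using assms cong_imp_coprime cong_sym coprime_mult_left_iff coprime_1_left by blast
  moreover have "[1 = h' * h] (mod n)" using assms by (simp add: cong_sym_eq mult.commute)
  ultimately show ?thesis
    using dedekind_sum_normalize[of h n 1 h'] by (simp add: dedekind_sum_commute)
qed

section \<open>The reciprocity law\<close>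

lemma sum_int_interval:
  fixes n :: int
  assumes "n \<ge> 0"
  shows "2 * (\<Sum>i=1..n. i) = n * (n + 1)" "6 * (\<Sum>i=1..n. i\<^sup>2) = n * (n + 1) * (2 * n + 1)"
proof -
  have ins: "{1..i + 1} = insert (i + 1) {1..i}" if "i \<ge> 0" for i :: int
    using that by auto
  show "2 * (\<Sum>i=1..n. i) = n * (n + 1)"
    using assms by (induction n rule: int_ge_induct) (simp_all add: ins algebra_simps)
  show "6 * (\<Sum>i=1..n. i\<^sup>2) = n * (n + 1) * (2 * n + 1)"
    using assms by (induction n rule: int_ge_induct) (simp_all add: ins algebra_simps power2_eq_square)
qed

lemma le_zdiv_iff_mult_le:
  fixes m n q :: int
  assumes "q > 0"
  shows "n \<le> m div q \<longleftrightarrow> n * q \<le> m"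
proof
  assume "n \<le> m div q"
  then have "n * q \<le> m div q * q" using assms by simp
  also have "\<dots> \<le> m" using assms by (simp add: minus_mod_eq_div_mult[symmetric])
  finally show "n * q \<le> m" .
next
  assume "n * q \<le> m"
  then show "n \<le> m div q" using zdiv_mono1[of "n * q" m q] assms by simp
qed

lemma zdiv_less_iff_less_mult:
  fixes m n q :: int
  assumes "q > 0"
  shows "m div q < n \<longleftrightarrow> m < n * q"
  using le_zdiv_iff_mult_le[OF assms, of n m] by linarith

text \<open>The left-hand side sums \<open>2 j\<close> over the lattice points \<open>(i, j)\<close> below the diagonal of a
  \<open>k \<times> h\<close> rectangle. No lattice point in the interior lies on the diagonal, as \<open>h\<close> and \<open>k\<close> are
  coprime, and summing row by row instead of column by column gives the right-hand side.\<close>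

lemma floor_double_count:
  fixes h k :: int
  assumes "h > 0" "k > 0" "coprime h k"
  shows "(\<Sum>i=1..k-1. (i * h div k)\<^sup>2 + i * h div k) =
    h * (h - 1) * (k - 1) - 2 * (\<Sum>j=1..h-1. j * (j * k div h))"
proof -
  have f: "i * h div k \<ge> 0" "i * h div k \<le> h - 1" if "i \<in> {1..k-1}" for i
  proof -
    show "i * h div k \<ge> 0" using that assms by (simp add: pos_imp_zdiv_nonneg_iff)
    have "i * h < h * k" using that assms by (simp add: mult.commute)
    then have "i * h div k < h" using assms by (simp add: zdiv_less_iff_less_mult)
    then show "i * h div k \<le> h - 1" by simp
  qed
  have "(\<Sum>i=1..k-1. (i * h div k)\<^sup>2 + i * h div k)
      = (\<Sum>i=1..k-1. \<Sum>j\<in>{j \<in> {1..h-1}. j \<le> i * h div k}. 2 * j)"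
  proof (rule sum.cong)
    fix i assume i: "i \<in> {1..k-1}"
    have "{j \<in> {1..h-1}. j \<le> i * h div k} = {1..i * h div k}" using f[OF i] by auto
    moreover have "(\<Sum>j=1..i * h div k. 2 * j) = (i * h div k)\<^sup>2 + i * h div k"
      using sum_int_interval(1)[OF f(1)[OF i]]
      by (simp only: sum_distrib_left[symmetric]) (simp add: power2_eq_square algebra_simps)
    ultimately show "(i * h div k)\<^sup>2 + i * h div k = (\<Sum>j\<in>{j \<in> {1..h-1}. j \<le> i * h div k}. 2 * j)"
      by simp
  qed simp
  also have "\<dots> = (\<Sum>j=1..h-1. \<Sum>i\<in>{i \<in> {1..k-1}. j \<le> i * h div k}. 2 * j)"
    by (rule sum.swap_restrict) auto
  also have "\<dots> = (\<Sum>j=1..h-1. 2 * j * (k - 1 - j * k div h))"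
  proof (rule sum.cong)
    fix j assume j: "j \<in> {1..h-1}"
    have nd: "j * k mod h \<noteq> 0"
      using mult_mod_nonzero[of k h j] assms j by (auto simp: coprime_commute)
    have "j * k < k * h" using j assms by (simp add: mult.commute)
    then have lt: "j * k div h < k" using assms by (simp only: zdiv_less_iff_less_mult)
    have nonneg: "j * k div h \<ge> 0" using j assms by (simp add: pos_imp_zdiv_nonneg_iff)
    have iff: "j \<le> i * h div k \<longleftrightarrow> j * k div h + 1 \<le> i" for i
    proof -
      have "j \<le> i * h div k \<longleftrightarrow> j * k \<le> i * h"
        using assms by (simp add: le_zdiv_iff_mult_le)
      also have "\<dots> \<longleftrightarrow> j * k < i * h"
        using nd by (metis mod_mult_self2_is_0 order_le_less)
      also have "\<dots> \<longleftrightarrow> j * k div h < i"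
        using assms by (simp add: zdiv_less_iff_less_mult)
      finally show ?thesis by linarith
    qed
    have "{i \<in> {1..k-1}. j \<le> i * h div k} = {j * k div h + 1..k-1}"
      unfolding iff using nonneg by auto
    then show "(\<Sum>i\<in>{i \<in> {1..k-1}. j \<le> i * h div k}. 2 * j) = 2 * j * (k - 1 - j * k div h)"
      using lt by simp
  qed simp
  also have "\<dots> = (\<Sum>j=1..h-1. (k - 1) * (2 * j) - 2 * (j * (j * k div h)))"
    by (rule sum.cong) (simp_all only: right_diff_distrib mult_ac)
  also have "\<dots> = (k - 1) * (2 * (\<Sum>j=1..h-1. j)) - 2 * (\<Sum>j=1..h-1. j * (j * k div h))"
    by (simp only: sum_distrib_left sum_subtractf)
  also have "2 * (\<Sum>j=1..h-1. j) = (h - 1) * h"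
    using sum_int_interval(1)[of "h - 1"] assms by simp
  finally show ?thesis by (simp add: mult_ac)
qed

text \<open>Only \<open>\<Sum> i \<lfloor>i h / k\<rfloor>\<close> depends on \<open>h\<close> in a subtle way: the residues \<open>i h mod k\<close> alone
  are a permutation of \<open>1, \<dots>, k - 1\<close>.\<close>

lemma dedekind_sum_floor:
  fixes h k :: int
  assumes "k > 0" "coprime h k"
  shows "dedekind_sum h 1 k = of_int h * (of_int k - 1) * (2 * of_int k - 1) / (6 * of_int k)
      - of_int (\<Sum>i=1..k-1. i * (i * h div k)) / of_int k - (of_int k - 1) / 4"
proof -
  define X where "X = (\<Sum>i=1..k-1. i * (i * h div k))"
  define H K where "H = real_of_int h" and "K = real_of_int k"
  have summand: "(of_int (i * h mod k) / of_int k - 1 / 2) * (of_int (i * 1 mod k) / of_int k - 1 / 2)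
      = real_of_int (h * i\<^sup>2 - k * (i * (i * h div k))) / (of_int k)\<^sup>2
        - of_int (i * h mod k) / (2 * of_int k) - of_int i / (2 * of_int k) + 1 / 4"
    if "i \<in> {1..k-1}" for i
  proof -
    have "i * h mod k = i * h - k * (i * h div k)" by (simp add: minus_mult_div_eq_mod)
    then have "h * i\<^sup>2 - k * (i * (i * h div k)) = i * (i * h mod k)"
      by (simp add: power2_eq_square right_diff_distrib mult_ac)
    moreover have "i * 1 mod k = i" using that by simp
    moreover have "(r / K - 1 / 2) * (x / K - 1 / 2) = x * r / K\<^sup>2 - r / (2 * K) - x / (2 * K) + 1 / 4" for r x
      by (simp add: power2_eq_square algebra_simps)
    ultimately show ?thesis by (simp only: K_def of_int_mult)
  qed
  have "dedekind_sum h 1 k = (\<Sum>i=1..k-1. real_of_int (h * i\<^sup>2 - k * (i * (i * h div k))) / (of_int k)\<^sup>2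
        - of_int (i * h mod k) / (2 * of_int k) - of_int i / (2 * of_int k) + 1 / 4)"
    unfolding dedekind_sum_residues by (rule sum.cong[OF refl summand])
  also have "\<dots> = of_int (\<Sum>i=1..k-1. h * i\<^sup>2 - k * (i * (i * h div k))) / K\<^sup>2
      - of_int (\<Sum>i=1..k-1. i * h mod k) / (2 * K) - of_int (\<Sum>i=1..k-1. i) / (2 * K) + (\<Sum>i=1..k-1. 1 / 4)"
    by (simp only: sum.distrib sum_subtractf sum_divide_distrib[symmetric] of_int_sum[symmetric] K_def)
  also have "(\<Sum>i=1..k-1. h * i\<^sup>2 - k * (i * (i * h div k))) = h * (\<Sum>i=1..k-1. i\<^sup>2) - k * X"
    by (simp only: sum_subtractf sum_distrib_left X_def)
  also have "(\<Sum>i=1..k-1. 1 / 4) = real_of_int (k - 1) / 4"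
    using assms(1) by simp
  also have "(\<Sum>i=1..k-1. i * h mod k) = (\<Sum>i=1..k-1. i)"
    using sum.reindex_bij_betw[OF bij_betw_mult_mod[OF assms(2)], of "\<lambda>x. x"] by simp
  also have "real_of_int (\<Sum>i=1..k-1. i) = (K - 1) * K / 2"
    using arg_cong[OF sum_int_interval(1)[of "k - 1"], of real_of_int] assms(1) by (simp add: K_def)
  also have "real_of_int (h * (\<Sum>i=1..k-1. i\<^sup>2) - k * X) = H * ((K - 1) * K * (2 * K - 1) / 6) - K * X"
  proof -
    have "real_of_int (\<Sum>i=1..k-1. i\<^sup>2) = (K - 1) * K * (2 * K - 1) / 6"
      using arg_cong[OF sum_int_interval(2)[of "k - 1"], of real_of_int] assms(1) by (simp add: K_def)
    then show ?thesis by (simp only: of_int_diff of_int_mult H_def K_def)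
  qed
  also have "(H * ((K - 1) * K * (2 * K - 1) / 6) - K * x) / K\<^sup>2 - (K - 1) * K / 2 / (2 * K) - (K - 1) * K / 2 / (2 * K)
      + of_int (k - 1) / 4 = H * (K - 1) * (2 * K - 1) / (6 * K) - x / K - (K - 1) / 4" for x
    using assms(1) by (simp add: K_def divide_simps power2_eq_square) (simp add: algebra_simps)
  finally show ?thesis by (simp add: X_def H_def K_def)
qed

text \<open>Comparing the sums of \<open>(i h mod k)\<^sup>2\<close> and of \<open>i\<^sup>2\<close>, which agree by permutation, expresses the
  nontrivial sum \<open>X\<close> for \<open>(h, k)\<close> by the sum of squared quotients \<open>F2\<close>. By double counting, \<open>F2\<close>
  in turn is given by the nontrivial sum \<open>Y\<close> for \<open>(k, h)\<close>. Hence \<open>X / k + Y / h\<close> is elementary.\<close>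

theorem dedekind_reciprocity:
  assumes "h > 0" "k > 0" "coprime h k"
  shows "dedekind_sum h 1 k + dedekind_sum k 1 h =
    - 1 / 4 + (of_int h / of_int k + of_int k / of_int h + 1 / (of_int h * of_int k)) / 12"
proof -
  have perm: "(\<Sum>i=1..n-1. g (i * c mod n)) = (\<Sum>i=1..n-1. g i)" if "coprime c n" for g :: "int \<Rightarrow> int" and c n
    by (rule sum.reindex_bij_betw[OF bij_betw_mult_mod[OF that]])
  define S1 S2 T1 T2 where "S1 = (\<Sum>i=1..k-1. i)" and "S2 = (\<Sum>i=1..k-1. i\<^sup>2)"
    and "T1 = (\<Sum>i=1..h-1. i)" and "T2 = (\<Sum>i=1..h-1. i\<^sup>2)"
  define F1 F2 where "F1 = (\<Sum>i=1..k-1. i * h div k)" and "F2 = (\<Sum>i=1..k-1. (i * h div k)\<^sup>2)"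
  define X Y where "X = (\<Sum>i=1..k-1. i * (i * h div k))" and "Y = (\<Sum>i=1..h-1. i * (i * k div h))"
  have r: "i * h mod k = h * i - k * (i * h div k)" for i
    by (simp add: minus_div_mult_eq_mod[symmetric] mult.commute)
  have e1: "h * S1 - k * F1 = S1"
  proof -
    have "S1 = (\<Sum>i=1..k-1. i * h mod k)" using perm[of h k "\<lambda>x. x"] assms by (simp add: S1_def)
    also have "\<dots> = h * S1 - k * F1"
      by (simp add: r S1_def F1_def sum_subtractf sum_distrib_left)
    finally show ?thesis by simp
  qed
  have e2: "h\<^sup>2 * S2 - 2 * h * k * X + k\<^sup>2 * F2 = S2"
  proof -
    have "S2 = (\<Sum>i=1..k-1. (i * h mod k)\<^sup>2)" using perm[of h k "\<lambda>x. x\<^sup>2"] assms by (simp add: S2_def)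
    also have "\<dots> = (\<Sum>i=1..k-1. h\<^sup>2 * i\<^sup>2 - 2 * h * k * (i * (i * h div k)) + k\<^sup>2 * (i * h div k)\<^sup>2)"
      by (simp add: r power2_eq_square algebra_simps)
    also have "\<dots> = h\<^sup>2 * S2 - 2 * h * k * X + k\<^sup>2 * F2"
      by (simp add: S2_def X_def F2_def sum.distrib sum_subtractf sum_distrib_left)
    finally show ?thesis by simp
  qed
  have e3: "F2 + F1 = h * (h - 1) * (k - 1) - 2 * Y"
    using floor_double_count[OF assms] by (simp add: F1_def F2_def Y_def sum.distrib)
  have s: "2 * S1 = (k - 1) * k" "6 * S2 = (k - 1) * k * (2 * k - 1)"
    "2 * T1 = (h - 1) * h" "6 * T2 = (h - 1) * h * (2 * h - 1)"
    using sum_int_interval[of "k - 1"] sum_int_interval[of "h - 1"] assms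
    by (simp_all add: S1_def S2_def T1_def T2_def algebra_simps)
  define H K where "H = real_of_int h" and "K = real_of_int k"
  have pos: "H > 0" "K > 0" using assms by (simp_all add: H_def K_def)
  have S1: "real_of_int S1 = (K - 1) * K / 2" using arg_cong[OF s(1), of real_of_int] by (simp add: K_def)
  have S2: "real_of_int S2 = (K - 1) * K * (2 * K - 1) / 6" using arg_cong[OF s(2), of real_of_int] by (simp add: K_def)
  have T1: "real_of_int T1 = (H - 1) * H / 2" using arg_cong[OF s(3), of real_of_int] by (simp add: H_def)
  have T2: "real_of_int T2 = (H - 1) * H * (2 * H - 1) / 6" using arg_cong[OF s(4), of real_of_int] by (simp add: H_def)
  have "H * S1 - K * F1 = S1" using arg_cong[OF e1, of real_of_int] by (simp add: K_def H_def)
  then have "K * real_of_int F1 = (H - 1) * S1" by (simp add: left_diff_distrib)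
  then have "K * real_of_int F1 = K * ((H - 1) * (K - 1) / 2)" by (simp add: S1)
  then have F1: "real_of_int F1 = (H - 1) * (K - 1) / 2" using pos by simp
  have F2: "real_of_int F2 = H * (H - 1) * (K - 1) - 2 * Y - F1"
    using arg_cong[OF e3, of real_of_int] by (simp add: K_def H_def)
  have "H\<^sup>2 * S2 - 2 * H * K * X + K\<^sup>2 * F2 = S2" using arg_cong[OF e2, of real_of_int] by (simp add: K_def H_def)
  then have X: "real_of_int X = ((H\<^sup>2 - 1) * S2 + K\<^sup>2 * F2) / (2 * H * K)" using pos by (simp add: field_simps)
  have XY: "X / K + Y / H = (H\<^sup>2 - 1) * (K - 1) * (2 * K - 1) / (12 * H * K) + (H - 1) * (K - 1) * (2 * H - 1) / (4 * H)"
    unfolding X F2 F1 S2 using pos by (simp add: divide_simps power2_eq_square) (simp add: algebra_simps)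
  have "dedekind_sum h 1 k = H * (K - 1) * (2 * K - 1) / (6 * K) - X / K - (K - 1) / 4"
    using dedekind_sum_floor[of k h] assms by (simp add: H_def K_def X_def)
  moreover have "dedekind_sum k 1 h = K * (H - 1) * (2 * H - 1) / (6 * H) - Y / H - (H - 1) / 4"
    using dedekind_sum_floor[of h k] assms by (simp add: H_def K_def Y_def coprime_commute)
  ultimately have "dedekind_sum h 1 k + dedekind_sum k 1 h =
      H * (K - 1) * (2 * K - 1) / (6 * K) + K * (H - 1) * (2 * H - 1) / (6 * H)
      - (X / K + Y / H) - (K - 1) / 4 - (H - 1) / 4"
    by simp
  also have "\<dots> = - 1 / 4 + (H / K + K / H + 1 / (H * K)) / 12"
    unfolding XY using pos by (simp add: divide_simps power2_eq_square) (simp add: algebra_simps)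
  finally show ?thesis by (simp add: H_def K_def)
qed

section \<open>The three-term relation\<close>

text \<open>The vectors \<open>(b, a)\<close> and \<open>(d, c)\<close> span a cone of index \<open>q = a d - b c\<close>, and \<open>(j, k)\<close> completes
  \<open>(d, c)\<close> to a basis, which provides the argument \<open>r = a j - b k\<close> for that cone. Both \<open>q\<close> and the
  class of \<open>r\<close> are unchanged under unimodular maps of the plane. So the Euclidean algorithm applies:
  shift the slopes \<open>a / b\<close> and \<open>c / d\<close> by an integer until \<open>0 \<le> c < d\<close>, then replace each slope \<open>x\<close> by
  \<open>- 1 / x\<close>, which makes \<open>c\<close> the new denominator. A shift changes no Dedekind sum, an inversion changes
  two of them by ordinary reciprocity.\<close>

theorem dedekind_three_term:
  fixes a b c d j k :: int
  assumes "b > 0" "d > 0" "coprime a b" "a * d - b * c > 0" "d * k - c * j = 1"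
  shows "dedekind_sum a 1 b - dedekind_sum c 1 d - dedekind_sum (a * j - b * k) 1 (a * d - b * c) =
    (((of_int b)\<^sup>2 + (of_int d)\<^sup>2 + (of_int (a * d - b * c))\<^sup>2)
      / (of_int b * of_int d * of_int (a * d - b * c)) - 3) / 12"
  using assms
proof (induction "nat d" arbitrary: a b c d j k rule: less_induct)
  case less
  define t where "t = c div d"
  define a' c' k' where "a' = a - b * t" and "c' = c - d * t" and "k' = k - t * j"
  have c': "c' = c mod d" by (simp add: c'_def t_def minus_mult_div_eq_mod)
  have c'_bounds: "0 \<le> c'" "c' < d" using less.prems(2) by (simp_all add: c')
  define q where "q = a * d - b * c"
  have q: "q = a' * d - b * c'" by (simp add: q_def a'_def c'_def algebra_simps)
  have r: "a * j - b * k = a' * j - b * k'" by (simp add: a'_def k'_def algebra_simps)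
  have jk: "d * k' - c' * j = 1" using less.prems(5) by (simp add: c'_def k'_def algebra_simps)
  have q_pos: "q > 0" using less.prems(4) by (simp add: q_def)
  have a'_pos: "a' > 0"
  proof -
    have "a' * d = q + b * c'" by (simp add: q)
    then have "a' * d > 0" using q_pos c'_bounds(1) less.prems(1) by (simp add: add_pos_nonneg)
    then show ?thesis using less.prems(2) by (simp add: zero_less_mult_iff)
  qed
  have "[a = a'] (mod b)" by (simp add: a'_def cong_iff_dvd_diff)
  then have cop_a': "coprime a' b" and cong_a: "dedekind_sum a 1 b = dedekind_sum a' 1 b"
    using less.prems(3) by (auto intro: cong_imp_coprime dedekind_sum_cong)
  have cong_c: "dedekind_sum c 1 d = dedekind_sum c' 1 d"
    by (rule dedekind_sum_cong) (simp_all add: c'_def cong_iff_dvd_diff)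
  define A B C D Q where "A = real_of_int a'" and "B = real_of_int b" and "C = real_of_int c'"
    and "D = real_of_int d" and "Q = real_of_int q"
  have pos: "A > 0" "B > 0" "D > 0" "Q > 0"
    using a'_pos less.prems q_pos by (simp_all add: A_def B_def D_def Q_def)
  have Q: "Q = A * D - B * C" by (simp add: Q_def q A_def B_def C_def D_def)
  have rec_a: "dedekind_sum a' 1 b = - 1 / 4 + (A / B + B / A + 1 / (A * B)) / 12 - dedekind_sum b 1 a'"
    using dedekind_reciprocity[OF a'_pos less.prems(1) cop_a'] by (simp add: A_def B_def)
  have main: "dedekind_sum a' 1 b - dedekind_sum c' 1 d - dedekind_sum (a' * j - b * k') 1 q =
      ((B\<^sup>2 + D\<^sup>2 + Q\<^sup>2) / (B * D * Q) - 3) / 12"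
  proof (cases "c' = 0")
    case True
    \<comment> \<open>The second vector is now \<open>(1, 0)\<close>, and the claim is ordinary reciprocity for \<open>a'\<close> and \<open>b\<close>.\<close>
    then have "d = 1" "k' = 1" using jk less.prems(2) by (auto simp: zmult_eq_1_iff)
    then have "q = a'" and "C = 0" and "D = 1" "Q = A"
      using True by (simp_all add: q C_def D_def Q_def A_def)
    have "dedekind_sum (a' * j - b * k') 1 q = dedekind_sum (- b) 1 a'"
      unfolding \<open>q = a'\<close> \<open>k' = 1\<close> by (rule dedekind_sum_cong) (simp_all add: cong_iff_dvd_diff)
    also have "\<dots> = - dedekind_sum b 1 a'"
      using cop_a' by (intro dedekind_sum_minus) (simp add: coprime_commute)
    finally have "dedekind_sum a' 1 b - dedekind_sum c' 1 d - dedekind_sum (a' * j - b * k') 1 q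
        = - 1 / 4 + (A / B + B / A + 1 / (A * B)) / 12"
      using \<open>d = 1\<close> rec_a by simp
    also have "\<dots> = ((B\<^sup>2 + D\<^sup>2 + Q\<^sup>2) / (B * D * Q) - 3) / 12"
      unfolding \<open>D = 1\<close> \<open>Q = A\<close> using pos by (simp add: divide_simps power2_eq_square)
    finally show ?thesis .
  next
    case False
    then have c'_pos: "c' > 0" using c'_bounds by simp
    have cop_c': "coprime c' d"
      by (rule coprimeI) (metis jk dvd_diff dvd_mult2)
    have C_pos: "C > 0" using c'_pos by (simp add: C_def)
    \<comment> \<open>The induction hypothesis for the inverted slopes \<open>- b / a'\<close> and \<open>- d / c'\<close>; note that \<open>c' < d\<close>.\<close>
    have "dedekind_sum (- b) 1 a' - dedekind_sum (- d) 1 c'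
        - dedekind_sum ((- b) * k' - a' * (- j)) 1 ((- b) * c' - a' * (- d)) =
        (((of_int a')\<^sup>2 + (of_int c')\<^sup>2 + (of_int ((- b) * c' - a' * (- d)))\<^sup>2)
          / (of_int a' * of_int c' * of_int ((- b) * c' - a' * (- d))) - 3) / 12"
    proof (rule less.hyps)
      show "nat c' < nat d" using c'_bounds c'_pos by simp
      show "coprime (- b) a'" using cop_a' by (simp add: coprime_commute)
      show "(- b) * c' - a' * (- d) > 0" using q_pos by (simp add: q)
      show "c' * (- j) - (- d) * k' = 1" using jk by simp
    qed (fact a'_pos c'_pos)+
    moreover have "(- b) * k' - a' * (- j) = a' * j - b * k'" "(- b) * c' - a' * (- d) = q"
      by (simp_all add: q)
    ultimately have IH: "dedekind_sum (- b) 1 a' - dedekind_sum (- d) 1 c' - dedekind_sum (a' * j - b * k') 1 q =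
        ((A\<^sup>2 + C\<^sup>2 + Q\<^sup>2) / (A * C * Q) - 3) / 12"
      by (simp only: A_def C_def Q_def)
    have neg: "dedekind_sum (- b) 1 a' = - dedekind_sum b 1 a'" "dedekind_sum (- d) 1 c' = - dedekind_sum d 1 c'"
      using cop_a' cop_c' by (simp_all add: dedekind_sum_minus coprime_commute)
    have rec_c: "dedekind_sum c' 1 d = - 1 / 4 + (C / D + D / C + 1 / (C * D)) / 12 - dedekind_sum d 1 c'"
      using dedekind_reciprocity[OF c'_pos less.prems(2) cop_c'] by (simp add: C_def D_def)
    have "dedekind_sum a' 1 b - dedekind_sum c' 1 d - dedekind_sum (a' * j - b * k') 1 q =
        ((A\<^sup>2 + C\<^sup>2 + Q\<^sup>2) / (A * C * Q) - 3) / 12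
        + (A / B + B / A + 1 / (A * B)) / 12 - (C / D + D / C + 1 / (C * D)) / 12"
      using IH unfolding neg rec_a rec_c by simp
    also have "\<dots> = ((B\<^sup>2 + D\<^sup>2 + Q\<^sup>2) / (B * D * Q) - 3) / 12"
    proof -
      have "B * D * (A\<^sup>2 + C\<^sup>2 + Q\<^sup>2) + C * D * Q * (A\<^sup>2 + B\<^sup>2 + 1) - A * B * Q * (C\<^sup>2 + D\<^sup>2 + 1)
          = A * C * (B\<^sup>2 + D\<^sup>2 + Q\<^sup>2)"
        unfolding Q by (simp add: power2_eq_square algebra_simps)
      then have "(B * D * (A\<^sup>2 + C\<^sup>2 + Q\<^sup>2) + C * D * Q * (A\<^sup>2 + B\<^sup>2 + 1) - A * B * Q * (C\<^sup>2 + D\<^sup>2 + 1)) / (A * B * C * D * Q)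
          = A * C * (B\<^sup>2 + D\<^sup>2 + Q\<^sup>2) / (A * B * C * D * Q)"
        by simp
      moreover have "A * C * (B\<^sup>2 + D\<^sup>2 + Q\<^sup>2) / (A * B * C * D * Q) = (B\<^sup>2 + D\<^sup>2 + Q\<^sup>2) / (B * D * Q)"
        using pos C_pos by (simp add: divide_simps)
      moreover have "(B * D * (A\<^sup>2 + C\<^sup>2 + Q\<^sup>2) + C * D * Q * (A\<^sup>2 + B\<^sup>2 + 1) - A * B * Q * (C\<^sup>2 + D\<^sup>2 + 1)) / (A * B * C * D * Q)
          = (A\<^sup>2 + C\<^sup>2 + Q\<^sup>2) / (A * C * Q) + (A / B + B / A + 1 / (A * B)) - (C / D + D / C + 1 / (C * D))"
        using pos C_pos by (simp add: divide_simps power2_eq_square) (simp add: algebra_simps)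
      ultimately have "(A\<^sup>2 + C\<^sup>2 + Q\<^sup>2) / (A * C * Q) + (A / B + B / A + 1 / (A * B)) - (C / D + D / C + 1 / (C * D))
          = (B\<^sup>2 + D\<^sup>2 + Q\<^sup>2) / (B * D * Q)"
        by simp
      then show ?thesis by argo
    qed
    finally show ?thesis .
  qed
  then show ?case
    unfolding cong_a cong_c q_def[symmetric] r by (simp add: B_def D_def Q_def)
qed

section \<open>The two cuts\<close>

text \<open>The four exponents and weights are kept as separate integers rather than as periodic sequences, so
  that a cyclic rotation of the indices is a reinterpretation of the locale. A lemma is then proved for one
  position of the indices and transported to the others by \<open>rotated\<close> and \<open>opposite\<close>.\<close>

locale kollar_quadruple =
  fixes a1 a2 a3 a4 w w1 w2 w3 w4 :: int
  assumes a_pos: "a1 > 0" "a2 > 0" "a3 > 0" "a4 > 0"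
    and w_pos: "w > 0"
    and nontrivial: "a1 \<noteq> 1 \<or> a3 \<noteq> 1" "a2 \<noteq> 1 \<or> a4 \<noteq> 1"
    and W: "w * w1 = a2 * a3 * a4 - a3 * a4 + a4 - 1"
      "w * w2 = a3 * a4 * a1 - a4 * a1 + a1 - 1"
      "w * w3 = a4 * a1 * a2 - a1 * a2 + a2 - 1"
      "w * w4 = a1 * a2 * a3 - a2 * a3 + a3 - 1"
    and coprime_opposite: "coprime w1 w3" "coprime w2 w4"
begin

lemma rotated: "kollar_quadruple a2 a3 a4 a1 w w2 w3 w4 w1"
  using a_pos w_pos nontrivial W coprime_opposite by unfold_locales (auto simp: coprime_commute)

lemma opposite: "kollar_quadruple a3 a4 a1 a2 w w3 w4 w1 w2"
  by (rule kollar_quadruple.rotated[OF rotated])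

lemma w1_pos: "w1 > 0"
proof -
  have "w * w1 = (a2 - 1) * (a3 * a4) + (a4 - 1)" by (simp add: W algebra_simps)
  moreover have "(a2 - 1) * (a3 * a4) \<ge> 0" "(a2 - 1) * (a3 * a4) > 0 \<or> a4 - 1 > 0"
    using a_pos nontrivial by auto
  ultimately have "w * w1 > 0" using a_pos by linarith
  then show ?thesis using w_pos by (simp add: zero_less_mult_iff)
qed

lemma w2_pos: "w2 > 0"
  by (rule kollar_quadruple.w1_pos[OF rotated])

lemma w4_pos: "w4 > 0"
  by (rule kollar_quadruple.w2_pos[OF opposite])

text \<open>The number \<open>a1 * w1 + w2\<close> is the degree \<open>d\<close> of the surface: it is \<open>(a1 a2 a3 a4 - 1) / w\<close>, and
  therefore invariant under rotation.\<close>

lemma degree: "w * (a1 * w1 + w2) = a1 * a2 * a3 * a4 - 1"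
proof -
  have "w * (a1 * w1 + w2) = a1 * (w * w1) + w * w2" by (simp add: algebra_simps)
  then show ?thesis by (simp add: W algebra_simps)
qed

lemma degree_rotate: "a2 * w2 + w3 = a1 * w1 + w2"
proof -
  have "w * (a2 * w2 + w3) = w * (a1 * w1 + w2)"
    using degree kollar_quadruple.degree[OF rotated] by (simp add: mult_ac)
  then show ?thesis using w_pos by simp
qed

lemma coprime_a4: "coprime a4 w" "coprime a4 w1"
proof -
  have one: "1 = a4 * (a2 * a3 - a3 + 1) - w * w1" by (simp add: W algebra_simps)
  have "c dvd 1" if "c dvd a4" "c dvd w * w1" for c
    by (subst one) (intro dvd_diff dvd_mult2 that)
  then show "coprime a4 w" "coprime a4 w1" by (auto intro!: coprimeI)
qed

lemma coprime_a: "coprime a1 w" "coprime a2 w" "coprime a3 w" "coprime a4 w"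
  using coprime_a4(1) kollar_quadruple.coprime_a4(1)[OF rotated] kollar_quadruple.coprime_a4(1)[OF opposite]
    kollar_quadruple.coprime_a4(1)[OF kollar_quadruple.rotated[OF opposite]] by auto

lemma coprime_w1_w2: "coprime w1 w2"
proof (rule coprimeI)
  fix c assume c: "c dvd w1" "c dvd w2"
  then have "c dvd a1 * w1 + w2 - a2 * w2" by simp
  also have "a1 * w1 + w2 - a2 * w2 = w3" using degree_rotate by simp
  finally show "c dvd 1" using c coprime_opposite(1) by (meson coprime_common_divisor)
qed

text \<open>This relation between opposite weights makes any common divisor of \<open>w4\<close> and \<open>a1 - 1\<close> divide \<open>w2\<close>
  too. It also evaluates the third argument in the three-term relation below.\<close>

lemma w2_via_w4: "w2 = w4 * (a4 * a1) - (a1 - 1) * (a1 * w1 + w2)"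
proof -
  have "w * (w4 * (a4 * a1) - (a1 - 1) * (a1 * w1 + w2)) =
      w * w4 * (a4 * a1) - (a1 - 1) * (w * (a1 * w1 + w2))" by (simp add: algebra_simps)
  also have "\<dots> = w * w2" unfolding degree W by (simp add: algebra_simps)
  finally show ?thesis using w_pos by simp
qed

lemma coprime_w4_a1: "coprime w4 (a1 - 1)"
proof (rule coprimeI)
  fix c assume c: "c dvd w4" "c dvd a1 - 1"
  then have "c dvd w2" by (subst w2_via_w4) simp
  then show "c dvd 1" using c(1) coprime_opposite(2) by (meson coprime_common_divisor)
qed

lemma coprime_w2_a3: "coprime w2 (a3 - 1)"
  by (rule kollar_quadruple.coprime_w4_a1[OF opposite])

text \<open>The modulus \<open>w\<close> is cut into \<open>a1 - 1\<close> and \<open>a3 - 1\<close>: the equation \<open>w w4 - (a1 - 1) a2 a3 = a3 - 1\<close>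
  says that the slopes \<open>w4 / (a1 - 1)\<close> and \<open>a2 a3 / w\<close> span a cone of index \<open>a3 - 1\<close>. The basis vector
  comes from \<open>(a2 a3) (a4 a1) - w d = 1\<close>.\<close>

lemma diagonal:
  assumes "a1 > 1" "a3 > 1"
  shows "dedekind_sum (a2 * a3) 1 w = dedekind_sum w4 1 (a1 - 1) + dedekind_sum w2 1 (a3 - 1)
    - (((of_int (a1 - 1))\<^sup>2 + (of_int w)\<^sup>2 + (of_int (a3 - 1))\<^sup>2) / (of_int (a1 - 1) * of_int w * of_int (a3 - 1)) - 3) / 12"
proof -
  define d where "d = a1 * w1 + w2"
  have q: "w4 * w - (a1 - 1) * (a2 * a3) = a3 - 1" using W(4) by (simp add: algebra_simps)
  have r: "w4 * (- (a4 * a1)) - (a1 - 1) * (- d) = - w2"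
    using w2_via_w4[folded d_def] by simp
  have unimodular: "w * (- d) - (a2 * a3) * (- (a4 * a1)) = 1"
    using degree[folded d_def] by (simp add: mult_ac)
  have "dedekind_sum w4 1 (a1 - 1) - dedekind_sum (a2 * a3) 1 w
      - dedekind_sum (w4 * (- (a4 * a1)) - (a1 - 1) * (- d)) 1 (w4 * w - (a1 - 1) * (a2 * a3)) =
      (((of_int (a1 - 1))\<^sup>2 + (of_int w)\<^sup>2 + (of_int (w4 * w - (a1 - 1) * (a2 * a3)))\<^sup>2)
        / (of_int (a1 - 1) * of_int w * of_int (w4 * w - (a1 - 1) * (a2 * a3))) - 3) / 12"
    by (rule dedekind_three_term[OF _ w_pos coprime_w4_a1 _ unimodular]) (use assms q in simp_all)
  then show ?thesis
    unfolding q r dedekind_sum_minus[OF coprime_w2_a3] by argo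
qed

text \<open>Modulo \<open>a4\<close> the equation for \<open>w1\<close> reads \<open>w w1 = -1\<close>.\<close>

lemma dedekind_sum_w: "dedekind_sum w 1 a4 = - dedekind_sum w1 1 a4"
proof -
  have "w * (- w1) - 1 = a4 * - (a2 * a3 - a3 + 1)" using W(1) by (simp add: algebra_simps)
  then have "[w * (- w1) = 1] (mod a4)" by (simp only: cong_iff_dvd_diff dvd_triv_left)
  then have "dedekind_sum (- w1) 1 a4 = dedekind_sum w 1 a4"
    by (rule dedekind_sum_inverse[symmetric])
  then show ?thesis
    using coprime_a4(2) by (simp add: dedekind_sum_minus coprime_commute)
qed

text \<open>The modulus \<open>w2\<close> is cut into \<open>a4\<close> and \<open>a1 - 1\<close>: computing the degree in two ways gives
  \<open>a4 w4 - (a1 - 1) w1 = w2\<close>, so the slopes \<open>- w1 / a4\<close> and \<open>- w4 / (a1 - 1)\<close> span a cone of index \<open>w2\<close>,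
  and its argument \<open>r\<close> satisfies \<open>r w4 = - w1\<close> modulo \<open>w2\<close>.\<close>

lemma vertex:
  assumes "a1 > 1"
  shows "dedekind_sum w4 w1 w2 = - dedekind_sum w 1 a4 - dedekind_sum w4 1 (a1 - 1)
    + (((of_int a4)\<^sup>2 + (of_int (a1 - 1))\<^sup>2 + (of_int w2)\<^sup>2) / (of_int a4 * of_int (a1 - 1) * of_int w2) - 3) / 12"
proof -
  have "a4 * w4 + w1 = a1 * w1 + w2"
    using degree_rotate kollar_quadruple.degree_rotate[OF rotated] kollar_quadruple.degree_rotate[OF opposite]
    by linarith
  then have q: "(- w1) * (a1 - 1) - a4 * (- w4) = w2" by (simp add: algebra_simps)
  obtain k j where kj: "(a1 - 1) * k - (- w4) * j = 1"
    using bezout_int[of "a1 - 1" w4] coprime_w4_a1 by (metis coprime_iff_gcd_eq_1 gcd.commute minus_mult_left diff_minus_eq_add mult.commute)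
  define r where "r = (- w1) * j - a4 * k"
  have three: "dedekind_sum (- w1) 1 a4 - dedekind_sum (- w4) 1 (a1 - 1) - dedekind_sum r 1 w2 =
      (((of_int a4)\<^sup>2 + (of_int (a1 - 1))\<^sup>2 + (of_int w2)\<^sup>2) / (of_int a4 * of_int (a1 - 1) * of_int w2) - 3) / 12"
    using dedekind_three_term[of a4 "a1 - 1" "- w1" "- w4" k j] assms a_pos coprime_a4(2) w2_pos kj
    unfolding q r_def by (simp add: coprime_commute)
  have "r * w4 = - w1 - k * w2"
  proof -
    have "r * w4 = - w1 * (w4 * j) - a4 * k * w4" by (simp add: r_def algebra_simps)
    also have "w4 * j = 1 - (a1 - 1) * k" using kj by simp
    also have "- w1 * (1 - (a1 - 1) * k) - a4 * k * w4 = - w1 - k * ((- w1) * (a1 - 1) - a4 * (- w4))"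
      by (simp add: algebra_simps)
    finally show ?thesis unfolding q .
  qed
  then have "[- w1 = r * w4] (mod w2)" by (simp add: cong_iff_dvd_diff)
  then have "dedekind_sum r 1 w2 = dedekind_sum (- w1) w4 w2"
    using coprime_opposite(2) by (intro dedekind_sum_normalize[symmetric]) (simp_all add: coprime_commute)
  also have "\<dots> = - dedekind_sum w4 w1 w2"
    unfolding dedekind_sum_minus[OF coprime_w1_w2] by (simp add: dedekind_sum_commute)
  finally have r: "dedekind_sum r 1 w2 = - dedekind_sum w4 w1 w2" .
  have "dedekind_sum (- w1) 1 a4 = dedekind_sum w 1 a4"
    by (simp add: dedekind_sum_minus dedekind_sum_w coprime_a4(2) coprime_commute)
  with three r show ?thesis
    unfolding dedekind_sum_minus[OF coprime_w4_a1] by argo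
qed

section \<open>A diagonal together with its two vertices\<close>

text \<open>This is the value of \<open>12 * diagonal_sum\<close>, arranged such that neither \<open>a1 - 1\<close> nor \<open>a3 - 1\<close> occurs in
  a denominator.\<close>

definition diagonal_term :: real where
  "diagonal_term = - 3 + of_int w / of_int a4 + of_int w / of_int a2
    - of_int a1 * (of_int a3 - 1) / of_int w2 - of_int a3 * (of_int a1 - 1) / of_int w4
    + (of_int a2 * of_int a4 - (1 + (of_int a3 - 1) * of_int a4) * (1 + (of_int a1 - 1) * of_int a2))
        / (of_int w * of_int w2 * of_int w4)
    + (of_int a1 + of_int a3 - 2 + 1 / of_int a2 + 1 / of_int a4) / of_int w"

text \<open>The pieces with modulus \<open>a1 - 1\<close> and \<open>a3 - 1\<close> occur in the first summand and, with opposite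
  sign, in the next two. The last two summands cancel the remaining pieces of the two vertices.\<close>

definition diagonal_sum :: real where
  "diagonal_sum = dedekind_sum (a2 * a3) 1 w + dedekind_sum w4 w1 w2 + dedekind_sum w2 w3 w4
    + dedekind_sum w 1 a2 + dedekind_sum w 1 a4"

lemma diagonal_sum_nondegenerate:
  assumes "a1 > 1" "a3 > 1"
  shows "12 * diagonal_sum = diagonal_term"
proof -
  define A B p r V W2 W4 where "A = real_of_int a4" and "B = real_of_int a2"
    and "p = real_of_int (a1 - 1)" and "r = real_of_int (a3 - 1)"
    and "V = real_of_int w" and "W2 = real_of_int w2" and "W4 = real_of_int w4"
  have pos: "A > 0" "B > 0" "p > 0" "r > 0" "V > 0" "W2 > 0" "W4 > 0"
    using a_pos assms w_pos w2_pos w4_pos by (simp_all add: A_def B_def p_def r_def V_def W2_def W4_def)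
  have VW2: "V * W2 = r * A * (1 + p) + p"
    using arg_cong[OF W(2), of real_of_int] by (simp add: V_def W2_def r_def A_def p_def algebra_simps)
  have VW4: "V * W4 = p * B * (1 + r) + r"
    using arg_cong[OF W(4), of real_of_int] by (simp add: V_def W4_def r_def B_def p_def algebra_simps)
  have "12 * diagonal_sum = - 3 - (p\<^sup>2 + V\<^sup>2 + r\<^sup>2) / (p * V * r)
      + (A\<^sup>2 + p\<^sup>2 + W2\<^sup>2) / (A * p * W2) + (B\<^sup>2 + r\<^sup>2 + W4\<^sup>2) / (B * r * W4)"
    unfolding diagonal_sum_def diagonal[OF assms] vertex[OF assms(1)] kollar_quadruple.vertex[OF opposite assms(2)]
      A_def[symmetric] B_def[symmetric] p_def[symmetric] r_def[symmetric] V_def[symmetric] W2_def[symmetric] W4_def[symmetric]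
    by (simp add: field_simps)
  also have "\<dots> = - 3 + V / A + V / B - (1 + p) * r / W2 - (1 + r) * p / W4
      + (B * A - (1 + r * A) * (1 + p * B)) / (V * W2 * W4) + (p + r + 1 / B + 1 / A) / V"
  proof -
    have p: "p = V * W2 - r * A * (1 + p)" and r: "r = V * W4 - p * B * (1 + r)"
      using VW2 VW4 by simp_all
    have 1: "p / (A * W2) = V / A - (1 + p) * r / W2"
      using pos by (subst p) (simp add: divide_simps)
    have 2: "r / (B * W4) = V / B - (1 + r) * p / W4"
      using pos by (subst r) (simp add: divide_simps)
    have "W2 = (r * A * (1 + p) + p) / V" "W4 = (p * B * (1 + r) + r) / V"
      using VW2 VW4 pos by (simp_all add: eq_divide_eq mult.commute)
    then have 3: "W2 / (A * p) + W4 / (B * r) = (p / r + r / p + p + r + 1 / B + 1 / A) / V"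
      using pos by (simp only:) (simp add: divide_simps, simp add: algebra_simps)
    have "V * (r * A * W4 + p * B * W2 - V * W2 * W4) =
        r * A * (V * W4) + p * B * (V * W2) - (V * W2) * (V * W4)"
      by (simp add: algebra_simps)
    also have "\<dots> = p * r * (B * A - (1 + r * A) * (1 + p * B))"
      unfolding VW2 VW4 by (simp add: algebra_simps)
    finally have key: "V * (r * A * W4 + p * B * W2 - V * W2 * W4) = p * r * (B * A - (1 + r * A) * (1 + p * B))" .
    have "A / (p * W2) + B / (r * W4) - V / (p * r) = V * (r * A * W4 + p * B * W2 - V * W2 * W4) / (V * p * r * W2 * W4)"
      using pos by (simp add: divide_simps)
    also have "\<dots> = (B * A - (1 + r * A) * (1 + p * B)) / (V * W2 * W4)"
      unfolding key using pos by (simp add: divide_simps)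
    finally have 4: "A / (p * W2) + B / (r * W4) - V / (p * r) = (B * A - (1 + r * A) * (1 + p * B)) / (V * W2 * W4)" .
    have "(p\<^sup>2 + V\<^sup>2 + r\<^sup>2) / (p * V * r) = V / (p * r) + (p / r + r / p) / V"
      "(A\<^sup>2 + p\<^sup>2 + W2\<^sup>2) / (A * p * W2) = A / (p * W2) + p / (A * W2) + W2 / (A * p)"
      "(B\<^sup>2 + r\<^sup>2 + W4\<^sup>2) / (B * r * W4) = B / (r * W4) + r / (B * W4) + W4 / (B * r)"
      using pos by (simp_all add: divide_simps power2_eq_square)
    then show ?thesis using 1 2 3 4 by (simp add: add_divide_distrib)
  qed
  also have "\<dots> = diagonal_term"
    by (simp add: diagonal_term_def A_def B_def p_def r_def V_def W2_def W4_def)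
  finally show ?thesis .
qed

text \<open>For \<open>a1 = 1\<close> the equations for the weights give \<open>w2 = a4 w4\<close>, which is compatible with \<open>w2\<close> and
  \<open>w4\<close> being coprime only if \<open>w4 = 1\<close>. One vertex sum is then empty, the other cancels \<open>s(w; a4)\<close>, and
  what is left of the sum is the reciprocity law for \<open>a2\<close> and \<open>w\<close>.\<close>

lemma diagonal_sum_degenerate:
  assumes "a1 = 1"
  shows "12 * diagonal_sum = diagonal_term"
proof -
  have "w * w2 = a4 * (w * w4)" unfolding W assms by (simp add: algebra_simps)
  then have w2: "w2 = a4 * w4" using w_pos by simp
  then have "w4 dvd 1" using coprime_opposite(2) by (simp add: coprime_common_divisor)
  then have w4: "w4 = 1" using w4_pos by simp
  then have w2: "w2 = a4" and a3: "a3 = w + 1" using w2 W(4) assms by (simp_all add: algebra_simps)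
  have "[a2 * a3 = a2] (mod w)" by (simp add: a3 cong_iff_dvd_diff algebra_simps)
  then have s1: "dedekind_sum (a2 * a3) 1 w = dedekind_sum a2 1 w" by (rule dedekind_sum_cong) simp
  have s2: "dedekind_sum w4 w1 w2 = - dedekind_sum w 1 a4"
    unfolding w2 w4 dedekind_sum_w by (simp add: dedekind_sum_commute[of 1])
  have "12 * diagonal_sum = 12 * (dedekind_sum a2 1 w + dedekind_sum w 1 a2)"
    unfolding diagonal_sum_def s1 s2 by (simp add: w4)
  also have "\<dots> = - 3 + (of_int a2 / of_int w + of_int w / of_int a2 + 1 / (of_int a2 * of_int w))"
    unfolding dedekind_reciprocity[OF a_pos(2) w_pos coprime_a(2)] by argo
  also have "\<dots> = diagonal_term"
    using a_pos w_pos unfolding diagonal_term_def unfolding assms w4 w2 a3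
    by (simp add: divide_simps) (simp add: algebra_simps)
  finally show ?thesis .
qed

lemma diagonal_sum_opposite:
  "kollar_quadruple.diagonal_sum a4 a1 a2 w w3 w4 w1 w2 = diagonal_sum"
proof -
  interpret opp: kollar_quadruple a3 a4 a1 a2 w w3 w4 w1 w2 by (rule opposite)
  have "a2 * a3 * (a4 * a1) - 1 = w * (a1 * w1 + w2)" using degree by (simp add: mult_ac)
  then have "[a2 * a3 * (a4 * a1) = 1] (mod w)" by (simp only: cong_iff_dvd_diff dvd_triv_left)
  then show ?thesis
    by (simp add: opp.diagonal_sum_def diagonal_sum_def dedekind_sum_inverse[of "a2 * a3" "a4 * a1"])
qed

lemma diagonal_term_opposite:
  "kollar_quadruple.diagonal_term a3 a4 a1 a2 w w4 w2 = diagonal_term"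
proof -
  interpret opp: kollar_quadruple a3 a4 a1 a2 w w3 w4 w1 w2 by (rule opposite)
  show ?thesis by (simp add: opp.diagonal_term_def diagonal_term_def mult_ac add_ac)
qed

lemma diagonal_sum_eq: "12 * diagonal_sum = diagonal_term"
proof -
  consider "a1 = 1" | "a3 = 1" | "a1 > 1" "a3 > 1" using a_pos by linarith
  then show ?thesis
  proof cases
    case 2
    show ?thesis
      using kollar_quadruple.diagonal_sum_degenerate[OF opposite 2]
      by (simp only: diagonal_sum_opposite diagonal_term_opposite)
  qed (simp_all add: diagonal_sum_degenerate diagonal_sum_nondegenerate)
qed

end

section \<open>The total\<close>

text \<open>What remains after all Dedekind sums have cancelled, cleared of denominators. The factors \<open>W\<^sub>i\<close> and
  \<open>D\<close> are \<open>w\<^sup>*\<close> times the weights and the degree.\<close>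

lemma kollar_polynomial_identity:
  fixes a1 a2 a3 a4 :: real
  defines "W1 \<equiv> a2 * a3 * a4 - a3 * a4 + a4 - 1" and "W2 \<equiv> a3 * a4 * a1 - a4 * a1 + a1 - 1"
    and "W3 \<equiv> a4 * a1 * a2 - a1 * a2 + a2 - 1" and "W4 \<equiv> a1 * a2 * a3 - a2 * a3 + a3 - 1"
    and "D \<equiv> a1 * a2 * a3 * a4 - 1"
  shows "- a4 * (a2 - 1) * (W2 * W3 * W4) - a1 * (a3 - 1) * (W1 * W3 * W4) - a2 * (a4 - 1) * (W1 * W2 * W4)
      - a3 * (a1 - 1) * (W1 * W2 * W3)
      + (a2 * a4 - (1 + (a3 - 1) * a4) * (1 + (a1 - 1) * a2)) * (W1 * W3)
      + (a3 * a1 - (1 + (a4 - 1) * a1) * (1 + (a2 - 1) * a3)) * (W2 * W4)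
    = D * (D - (W1 + W2 + W3 + W4))\<^sup>2
      - 2 * (W2 * W3 * W4 + W1 * W3 * W4 + W1 * W2 * W4 + W1 * W2 * W3) - W1 * W2 * W3 * W4"
  unfolding assms by algebra

context kollar_quadruple
begin

text \<open>The first six sums are the ones modulo \<open>w\<^sup>*\<close> in normalised form. Each of the two diagonals is
  completed to a \<open>diagonal_sum\<close>, at the price of the sums \<open>s(w; a\<^sub>i)\<close>, and these combine with
  \<open>s(a\<^sub>i; w)\<close> by reciprocity.\<close>

theorem dedekind_sums_total:
  defines "d \<equiv> a1 * w1 + w2"
  shows "12 * (dedekind_sum (a2 * a3) 1 w + dedekind_sum (a3 * a4) 1 w
      - (dedekind_sum a1 1 w + dedekind_sum a2 1 w + dedekind_sum a3 1 w + dedekind_sum a4 1 w)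
      + (dedekind_sum w3 w4 w1 + dedekind_sum w4 w1 w2 + dedekind_sum w1 w2 w3 + dedekind_sum w2 w3 w4))
    = of_int d * (of_int d - (of_int w1 + of_int w2 + of_int w3 + of_int w4))\<^sup>2
        / (of_int w1 * of_int w2 * of_int w3 * of_int w4)
      - (2 / of_int w1 + 2 / of_int w2 + 2 / of_int w3 + 2 / of_int w4)
      - ((of_int w)\<^sup>2 - 6 * of_int w + 4) / of_int w"
proof -
  interpret rot: kollar_quadruple a2 a3 a4 a1 w w2 w3 w4 w1 by (rule rotated)
  define A1 A2 A3 A4 V X1 X2 X3 X4 E where
    "A1 = real_of_int a1" and "A2 = real_of_int a2" and "A3 = real_of_int a3" and "A4 = real_of_int a4"
    and "V = real_of_int w" and "X1 = real_of_int w1" and "X2 = real_of_int w2"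
    and "X3 = real_of_int w3" and "X4 = real_of_int w4" and "E = real_of_int d"
  note real_defs = A1_def A2_def A3_def A4_def V_def X1_def X2_def X3_def X4_def E_def
  have pos: "A1 > 0" "A2 > 0" "A3 > 0" "A4 > 0" "V > 0" "X1 > 0" "X2 > 0" "X3 > 0" "X4 > 0"
    using a_pos w_pos w1_pos w2_pos rot.w2_pos w4_pos by (simp_all add: real_defs)
  have VX: "V * X1 = A2 * A3 * A4 - A3 * A4 + A4 - 1" "V * X2 = A3 * A4 * A1 - A4 * A1 + A1 - 1"
    "V * X3 = A4 * A1 * A2 - A1 * A2 + A2 - 1" "V * X4 = A1 * A2 * A3 - A2 * A3 + A3 - 1"
    "V * E = A1 * A2 * A3 * A4 - 1"
    using W[THEN arg_cong, of real_of_int] degree[folded d_def, THEN arg_cong, of real_of_int] by (simp_all add: real_defs)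
  define N13 N24 where "N13 = A2 * A4 - (1 + (A3 - 1) * A4) * (1 + (A1 - 1) * A2)"
    and "N24 = A3 * A1 - (1 + (A4 - 1) * A1) * (1 + (A2 - 1) * A3)"
  \<comment> \<open>The polynomial identity with \<open>V * Xi\<close> for \<open>Wi\<close> and \<open>V * E\<close> for \<open>D\<close>.\<close>
  have cleared: "V ^ 3 * (- A4 * (A2 - 1) * (X2 * X3 * X4) - A1 * (A3 - 1) * (X1 * X3 * X4) - A2 * (A4 - 1) * (X1 * X2 * X4)
      - A3 * (A1 - 1) * (X1 * X2 * X3)) + V\<^sup>2 * (N13 * (X1 * X3) + N24 * (X2 * X4))
    = V ^ 3 * (E * (E - (X1 + X2 + X3 + X4))\<^sup>2
      - 2 * (X2 * X3 * X4 + X1 * X3 * X4 + X1 * X2 * X4 + X1 * X2 * X3) - V * (X1 * X2 * X3 * X4))"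
    using kollar_polynomial_identity[where ?a1.0 = A1 and ?a2.0 = A2 and ?a3.0 = A3 and ?a4.0 = A4] unfolding N13_def N24_def VX[symmetric]
    by (simp add: power2_eq_square power3_eq_cube algebra_simps)
  have rational: "- A4 * (A2 - 1) / X1 - A1 * (A3 - 1) / X2 - A2 * (A4 - 1) / X3 - A3 * (A1 - 1) / X4
      + N13 / (V * X2 * X4) + N24 / (V * X3 * X1)
    = E * (E - (X1 + X2 + X3 + X4))\<^sup>2 / (X1 * X2 * X3 * X4) - (2 / X1 + 2 / X2 + 2 / X3 + 2 / X4) - V"
  proof -
    have "- A4 * (A2 - 1) / X1 - A1 * (A3 - 1) / X2 - A2 * (A4 - 1) / X3 - A3 * (A1 - 1) / X4
        + N13 / (V * X2 * X4) + N24 / (V * X3 * X1)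
      = (V ^ 3 * (- A4 * (A2 - 1) * (X2 * X3 * X4) - A1 * (A3 - 1) * (X1 * X3 * X4) - A2 * (A4 - 1) * (X1 * X2 * X4)
          - A3 * (A1 - 1) * (X1 * X2 * X3)) + V\<^sup>2 * (N13 * (X1 * X3) + N24 * (X2 * X4))) / (V ^ 3 * (X1 * X2 * X3 * X4))"
      using pos by (simp add: add_divide_distrib diff_divide_distrib distrib_left right_diff_distrib
          power2_eq_square power3_eq_cube mult_ac)
    also note cleared
    also have "V ^ 3 * (E * (E - (X1 + X2 + X3 + X4))\<^sup>2
        - 2 * (X2 * X3 * X4 + X1 * X3 * X4 + X1 * X2 * X4 + X1 * X2 * X3) - V * (X1 * X2 * X3 * X4)) / (V ^ 3 * (X1 * X2 * X3 * X4))
      = E * (E - (X1 + X2 + X3 + X4))\<^sup>2 / (X1 * X2 * X3 * X4) - (2 / X1 + 2 / X2 + 2 / X3 + 2 / X4) - V"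
      using pos by (simp add: add_divide_distrib diff_divide_distrib distrib_left mult_ac)
    finally show ?thesis .
  qed
  have rec: "12 * (dedekind_sum x 1 w + dedekind_sum w 1 x) = - 3 + (of_int x / V + V / of_int x + 1 / (of_int x * V))"
    if "x > 0" "coprime x w" for x
    unfolding dedekind_reciprocity[OF that(1) w_pos that(2)] V_def by argo
  have "12 * (dedekind_sum (a2 * a3) 1 w + dedekind_sum (a3 * a4) 1 w
      - (dedekind_sum a1 1 w + dedekind_sum a2 1 w + dedekind_sum a3 1 w + dedekind_sum a4 1 w)
      + (dedekind_sum w3 w4 w1 + dedekind_sum w4 w1 w2 + dedekind_sum w1 w2 w3 + dedekind_sum w2 w3 w4))
    = 12 * diagonal_sum + 12 * rot.diagonal_sum
      - (12 * (dedekind_sum a1 1 w + dedekind_sum w 1 a1) + 12 * (dedekind_sum a2 1 w + dedekind_sum w 1 a2)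
       + 12 * (dedekind_sum a3 1 w + dedekind_sum w 1 a3) + 12 * (dedekind_sum a4 1 w + dedekind_sum w 1 a4))"
    unfolding diagonal_sum_def rot.diagonal_sum_def by argo
  also have "\<dots> = diagonal_term + rot.diagonal_term + 12
      - (A1 / V + V / A1 + 1 / (A1 * V) + A2 / V + V / A2 + 1 / (A2 * V)
       + A3 / V + V / A3 + 1 / (A3 * V) + A4 / V + V / A4 + 1 / (A4 * V))"
    unfolding diagonal_sum_eq rot.diagonal_sum_eq
      rec[OF a_pos(1) coprime_a(1)] rec[OF a_pos(2) coprime_a(2)] rec[OF a_pos(3) coprime_a(3)] rec[OF a_pos(4) coprime_a(4)]
    by (simp add: real_defs)
  also have "\<dots> = - A4 * (A2 - 1) / X1 - A1 * (A3 - 1) / X2 - A2 * (A4 - 1) / X3 - A3 * (A1 - 1) / X4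
      + N13 / (V * X2 * X4) + N24 / (V * X3 * X1) + 6 - 4 / V"
    unfolding diagonal_term_def rot.diagonal_term_def real_defs[symmetric]
    by (simp add: N13_def N24_def add_divide_distrib diff_divide_distrib)
  also have "\<dots> = E * (E - (X1 + X2 + X3 + X4))\<^sup>2 / (X1 * X2 * X3 * X4) - (2 / X1 + 2 / X2 + 2 / X3 + 2 / X4)
      - (V\<^sup>2 - 6 * V + 4) / V"
    unfolding rational using pos by (simp add: add_divide_distrib diff_divide_distrib power2_eq_square)
  finally show ?thesis unfolding real_defs .
qed

end

lemma kollar_wstar_mult_w:
  assumes "kollar_exponents a"
  shows "kollar_wstar a * kollar_w a i = kollar_W a i"
  using kollar_wstar_dvd_W[OF assms] by (simp add: kollar_w_def)

lemma kollar_quadruple_exponents: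
  assumes "kollar_exponents a" "kollar_wstar a > 1"
    and "\<forall>i. gcd (kollar_w a i) (kollar_w a (i + 2)) = 1"
  shows "kollar_quadruple (a 1) (a 2) (a 3) (a 4) (kollar_wstar a)
    (kollar_w a 1) (kollar_w a 2) (kollar_w a 3) (kollar_w a 4)"
proof
  have "a (i + 4) = a i" for i using assms(1) by (simp add: kollar_exponents_def)
  from this[of 1] this[of 2] this[of 3] have period: "a 5 = a 1" "a 6 = a 2" "a 7 = a 3"
    by simp_all
  show "a 1 > 0" "a 2 > 0" "a 3 > 0" "a 4 > 0"
    using assms(1) by (simp_all add: kollar_exponents_def)
  show "kollar_wstar a > 0" using assms(2) by simp
  have "(a i, a (i + 2)) \<noteq> (1, 1)" for i using assms(1) by (simp add: kollar_exponents_def)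
  from this[of 1] this[of 2] show "a 1 \<noteq> 1 \<or> a 3 \<noteq> 1" "a 2 \<noteq> 1 \<or> a 4 \<noteq> 1"
    by (auto simp: numeral_eq_Suc)
  have index: "(1::nat) + 1 = 2" "(1::nat) + 2 = 3" "(1::nat) + 3 = 4" "(2::nat) + 1 = 3" "(2::nat) + 2 = 4"
    "(2::nat) + 3 = 5" "(3::nat) + 1 = 4" "(3::nat) + 2 = 5" "(3::nat) + 3 = 6" "(4::nat) + 1 = 5"
    "(4::nat) + 2 = 6" "(4::nat) + 3 = 7"
    by simp_all
  show "kollar_wstar a * kollar_w a 1 = a 2 * a 3 * a 4 - a 3 * a 4 + a 4 - 1"
    "kollar_wstar a * kollar_w a 2 = a 3 * a 4 * a 1 - a 4 * a 1 + a 1 - 1"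
    "kollar_wstar a * kollar_w a 3 = a 4 * a 1 * a 2 - a 1 * a 2 + a 2 - 1"
    "kollar_wstar a * kollar_w a 4 = a 1 * a 2 * a 3 - a 2 * a 3 + a 3 - 1"
    unfolding kollar_wstar_mult_w[OF assms(1)] kollar_W_def index period by (rule refl)+
  show "coprime (kollar_w a 1) (kollar_w a 3)" "coprime (kollar_w a 2) (kollar_w a 4)"
    using assms(3)[rule_format, of 1] assms(3)[rule_format, of 2] by (simp_all add: coprime_iff_gcd_eq_1 numeral_eq_Suc)
qed

theorem corollary5p8:
  fixes a \<mu> :: "nat \<Rightarrow> int"
  assumes "kollar_exponents a"
    and "kollar_wstar a > 1"
    and "\<forall>i\<in>{1..4}. 0 < \<mu> i \<and> \<mu> i < kollar_wstar a"
    and "[\<mu> 1 = a 2 * a 3 * a 4] (mod kollar_wstar a)"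
    and "[\<mu> 2 = - (a 3 * a 4)] (mod kollar_wstar a)"
    and "[\<mu> 3 = a 4] (mod kollar_wstar a)"
    and "[\<mu> 4 = - 1] (mod kollar_wstar a)"
    and "\<forall>i. gcd (kollar_w a i) (kollar_w a (i + 2)) = 1"
  shows "12 * ((\<Sum>i=1..4. \<Sum>j\<in>{i<..4}. dedekind_sum (\<mu> i) (\<mu> j) (kollar_wstar a))
             + (\<Sum>i=1..4. dedekind_sum (kollar_w a (i + 2)) (kollar_w a (i + 3)) (kollar_w a i)))
       = real_of_int (kollar_d a) * (real_of_int (kollar_d a) - (\<Sum>i=1..4. real_of_int (kollar_w a i)))\<^sup>2
           / (\<Prod>i=1..4. real_of_int (kollar_w a i))
         - (\<Sum>i=1..4. 2 / real_of_int (kollar_w a i))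
         - ((real_of_int (kollar_wstar a))\<^sup>2 - 6 * real_of_int (kollar_wstar a) + 4)
             / real_of_int (kollar_wstar a)"
proof -
  interpret kollar_quadruple "a 1" "a 2" "a 3" "a 4" "kollar_wstar a"
      "kollar_w a 1" "kollar_w a 2" "kollar_w a 3" "kollar_w a 4"
    by (rule kollar_quadruple_exponents[OF assms(1,2,8)])
  let ?w = "kollar_wstar a"
  have sum4: "(\<Sum>i=1..4. f i) = f 1 + f 2 + f 3 + f 4" for f :: "nat \<Rightarrow> real"
    by (simp add: eval_nat_numeral)
  have prod4: "(\<Prod>i=1..4. f i) = f 1 * f 2 * f 3 * f 4" for f :: "nat \<Rightarrow> real"
    by (simp add: eval_nat_numeral)
  have above: "{1<..4} = {2, 3, 4::nat}" "{2<..4} = {3, 4::nat}" "{3<..4} = {4::nat}"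
    by auto
  have period: "kollar_w a 5 = kollar_w a 1" "kollar_w a 6 = kollar_w a 2" "kollar_w a 7 = kollar_w a 3"
    using kollar_W_periodic[OF assms(1), of 1] kollar_W_periodic[OF assms(1), of 2] kollar_W_periodic[OF assms(1), of 3]
    by (simp_all add: kollar_w_def)
  have d: "kollar_d a = a 1 * kollar_w a 1 + kollar_w a 2"
  proof -
    have "kollar_D a = ?w * (a 1 * kollar_w a 1 + kollar_w a 2)"
      unfolding kollar_D_eq[OF assms(1)] kollar_wstar_mult_w[OF assms(1), symmetric] by (simp add: algebra_simps)
    then show ?thesis using w_pos by (simp add: kollar_d_def)
  qed
  have s: "dedekind_sum (\<mu> i) (\<mu> j) ?w = dedekind_sum x y ?w"
    if "[\<mu> i = x] (mod ?w)" "[\<mu> j = y] (mod ?w)" for i j x y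
    using that by (rule dedekind_sum_cong)
  \<comment> \<open>Consecutive \<open>\<mu>\<close> differ by the factor \<open>- a\<close>, also from \<open>\<mu> 4\<close> back to \<open>\<mu> 1\<close>, since the product of
    the four exponents is 1 modulo \<open>w\<^sup>*\<close>.\<close>
  have edges: "dedekind_sum (\<mu> 1) (\<mu> 2) ?w = - dedekind_sum (a 2) 1 ?w"
    "dedekind_sum (\<mu> 2) (\<mu> 3) ?w = - dedekind_sum (a 3) 1 ?w"
    "dedekind_sum (\<mu> 3) (\<mu> 4) ?w = - dedekind_sum (a 4) 1 ?w"
    "dedekind_sum (\<mu> 1) (\<mu> 4) ?w = - dedekind_sum (a 1) 1 ?w"
    "dedekind_sum (\<mu> 1) (\<mu> 3) ?w = dedekind_sum (a 2 * a 3) 1 ?w"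
    "dedekind_sum (\<mu> 2) (\<mu> 4) ?w = dedekind_sum (a 3 * a 4) 1 ?w"
  proof -
    define p q r v where "p = a 1" and "q = a 2" and "r = a 3" and "v = a 4"
    note cong = assms(4-7)[folded p_def q_def r_def v_def]
    note cop = coprime_a[folded p_def q_def r_def v_def]
    have prod: "[q * r * v * p = 1] (mod ?w)"
    proof -
      have "q * r * v * p - 1 = ?w * (p * kollar_w a 1 + kollar_w a 2)"
        using degree by (simp add: p_def q_def r_def v_def mult_ac)
      then show ?thesis by (simp only: cong_iff_dvd_diff dvd_triv_left)
    qed
    have n: "dedekind_sum (h * b) b ?w = dedekind_sum h 1 ?w" if "coprime b ?w" for h b
      by (rule dedekind_sum_normalize[OF that cong_refl])
    have m: "dedekind_sum (- h) 1 ?w = - dedekind_sum h 1 ?w" if "coprime h ?w" for h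
      by (rule dedekind_sum_minus[OF that])
    have cop': "coprime (- (r * v)) ?w" "coprime v ?w" "coprime (- 1) ?w" "coprime (q * r * v) ?w"
      using cop by simp_all
    show "dedekind_sum (\<mu> 1) (\<mu> 2) ?w = - dedekind_sum (a 2) 1 ?w"
      using s[OF cong(1,2)] n[OF cop'(1), of "- q"] m[OF cop(2)] by (simp add: q_def mult_ac)
    show "dedekind_sum (\<mu> 2) (\<mu> 3) ?w = - dedekind_sum (a 3) 1 ?w"
      using s[OF cong(2,3)] n[OF cop'(2), of "- r"] m[OF cop(3)] by (simp add: r_def)
    show "dedekind_sum (\<mu> 3) (\<mu> 4) ?w = - dedekind_sum (a 4) 1 ?w"
      using s[OF cong(3,4)] n[OF cop'(3), of "- v"] m[OF cop(4)] by (simp add: v_def)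
    show "dedekind_sum (\<mu> 1) (\<mu> 4) ?w = - dedekind_sum (a 1) 1 ?w"
      using s[OF cong(1,4)] n[OF cop'(3), of "- (q * r * v)"] m[OF cop'(4)] dedekind_sum_inverse[OF prod]
      by (simp add: p_def)
    show "dedekind_sum (\<mu> 1) (\<mu> 3) ?w = dedekind_sum (a 2 * a 3) 1 ?w"
      using s[OF cong(1,3)] n[OF cop'(2), of "q * r"] by (simp add: q_def r_def)
    show "dedekind_sum (\<mu> 2) (\<mu> 4) ?w = dedekind_sum (a 3 * a 4) 1 ?w"
      using s[OF cong(2,4)] n[OF cop'(3), of "r * v"] by (simp add: r_def v_def)
  qed
  have \<mu>_sum: "(\<Sum>i=1..4. \<Sum>j\<in>{i<..4}. dedekind_sum (\<mu> i) (\<mu> j) ?w)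
      = dedekind_sum (a 2 * a 3) 1 ?w + dedekind_sum (a 3 * a 4) 1 ?w
        - (dedekind_sum (a 1) 1 ?w + dedekind_sum (a 2) 1 ?w + dedekind_sum (a 3) 1 ?w + dedekind_sum (a 4) 1 ?w)"
    unfolding sum4 above by (simp add: edges[unfolded One_nat_def])
  have index: "(1::nat) + 2 = 3" "(1::nat) + 3 = 4" "(2::nat) + 2 = 4" "(2::nat) + 3 = 5"
    "(3::nat) + 2 = 5" "(3::nat) + 3 = 6" "(4::nat) + 2 = 6" "(4::nat) + 3 = 7"
    by simp_all
  have w_sum: "(\<Sum>i=1..4. dedekind_sum (kollar_w a (i + 2)) (kollar_w a (i + 3)) (kollar_w a i)) =
      dedekind_sum (kollar_w a 3) (kollar_w a 4) (kollar_w a 1) + dedekind_sum (kollar_w a 4) (kollar_w a 1) (kollar_w a 2)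
      + dedekind_sum (kollar_w a 1) (kollar_w a 2) (kollar_w a 3) + dedekind_sum (kollar_w a 2) (kollar_w a 3) (kollar_w a 4)"
    unfolding sum4 index period by (rule refl)
  show ?thesis
    unfolding \<mu>_sum w_sum unfolding sum4 prod4 d by (rule dedekind_sums_total)
qed

end
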